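(* Let $(G,F)$ be a sorted profinite group. The following are equivalent: (1) $(G,F)$ has the sorted embedding property (SEP). (2) $(G,F)$ has the finitely sorted embedding property (FSEP). (3) $G$ has the embedding property (EP) as a profinite group, and for all $N,N'\in\mathcal N(G)$ with $G/N\cong G/N'$ one has $F(N)=F(N')$.
   Context: Fix a set $\mathcal J$ (of "sorts"). $\mathbb N$ is the set of positive integers and $\mathcal J^{<\mathbb N}=\bigcup_{n\in\mathbb N}\mathcal J^n$. For $J=(j_1,\dots,j_n)$ put $\|J\|=\{j_1,\dots,j_n\}$ and $\sqrt J=\{J'\in\mathcal J^{<\mathbb N}:\|J\|\subseteq\|J'\|\}$; $J^\frown J'$ is concatenation. Fix an arbitrary function $J^*_\subseteq:\mathbb N\times\mathcal J^{<\mathbb N}\to\mathcal J^{<\mathbb N}$ and put $J^*_\cap(J,J')=J^\frown J'$. For a profinite group $G$, $\mathcal N(G)$ is the set of open normal subgroups. A sorting data on $G$ is a family $F=\{F(N):N\in\mathcal N(G)\}$ of non-empty subsets of $\mathcal J^{<\mathbb N}$ such that: (i) $F(G)=\mathcal J^{<\mathbb N}$; (ii) $J\in F(N)\Leftrightarrow\sqrt J\subseteq F(N)$; (iii) if $N_1\subseteq N_2$, $[G:N_1]\le k$ and $J\in F(N_1)$, then $J^*_\subseteq(k,J)\in F(N_2)$; (iv) if $J_1\in F(N_1)$, $J_2\in F(N_2)$, then $J^*_\cap(J_1,J_2)\in F(N_1\cap N_2)$. The pair $(G,F)$ is a sorted profinite group. A morphism $(G_1,F_1)\to(G_2,F_2)$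 is a continuous surjective homomorphism $f:G_1\to G_2$ with $F_2(N)\subseteq F_1(f^{-1}[N])$ for all $N\in\mathcal N(G_2)$. This defines the category of sorted profinite groups. A sorted profinite group $(A,F_A)$ is a quotient of $(G,F)$ if there is a morphism $(G,F)\to(A,F_A)$. $\mathrm{SIm}(G,F)$ is the set of isomorphism classes of finite (i.e. $A$ finite) quotients of $(G,F)$. A sorting data $F$ on $G$ is finitely generated if there are $X\subseteq\mathcal N(G)$ with $\bigcap X=\{e\}$ and non-empty finite sets $F_X(N)\subseteq\mathcal J^{<\mathbb N}$ ($N\in X$) such that $F$ is the smallest sorting data on $G$ with $F_X(N)\subseteq F(N)$ for all $N\in X$; then $(G,F)$ is called finitely sorted. $\mathrm{FSIm}(G,F)$ is the set of isomorphism classes of finitely sorted finite quotients of $(G,F)$. $(G,F)$ has SEP (resp. FSEP) if for all $(A,F_A),(B,F_B)$ in $\mathrm{SIm}(G,F)$ (resp. in $\mathrm{FSIm}(G,F)$) and all morphisms $\Pi:(A,F_A)\to(B,F_B)$ and $\varphi:(G,F)\to(B,F_B)$ there is a morphism $\psi:(G,F)\to(A,F_A)$ with $\Pi\circ\psi=\varphi$. $G$ has EP if for all finite quotients $A,B$ of $G$ (up to isomorphism) and all (continuous) epimorphisms $\Pi:A\to B$, $\varphi:G\to B$ there is an epimorphism $\psi:G\to A$ with $\Pi\circ\psi=\varphi$. *)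

theory Defs
  imports "HOL-Analysis.Abstract_Topological_Spaces" "HOL-Algebra.Coset"
begin

section \<open>Profinite groups\<close>

record 'a topgroup = "'a monoid" +
  group_topology :: "'a topology"

locale topological_group = group G for G (structure) +
  assumes topspace_eq: "topspace (group_topology G) = carrier G"
    and continuous_mult:
      "continuous_map (prod_topology (group_topology G) (group_topology G))
         (group_topology G) (\<lambda>(x, y). x \<otimes> y)"
    and continuous_inv:
      "continuous_map (group_topology G) (group_topology G) (\<lambda>x. inv x)"

locale profinite_group = topological_group +
  assumes compact: "compact_space (group_topology G)"
    and Hausdorff: "Hausdorff_space (group_topology G)"
    and totally_disconnected:
      "\<And>S. connectedin (group_topology G) S \<Longrightarrow> \<exists>a. S \<subseteq> {a}"

definition open_normal_subgroups :: "('a, 'm) topgroup_scheme \<Rightarrow> 'a set set" where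
  "open_normal_subgroups G = {N. N \<lhd> G \<and> openin (group_topology G) N}"

definition continuous_epi ::
    "('a, 'm) topgroup_scheme \<Rightarrow> ('b, 'n) topgroup_scheme \<Rightarrow> ('a \<Rightarrow> 'b) set" where
  "continuous_epi G H = {f \<in> epi G H. continuous_map (group_topology G) (group_topology H) f}"


section \<open>Sorting data\<close>

text \<open>
  The set of sorts is the type \<open>'j\<close>, and \<open>words\<close> is the set of non-empty finite sequences of
  sorts. The support of a word \<open>J\<close> is \<open>set J\<close>, and concatenation of words is \<open>J @ J'\<close>. The
  arbitrary function attached to inclusions is a parameter \<open>Jsub\<close>, defined on pairs of a
  positive integer and a word; its values at other arguments are never used.
\<close>

definition words :: "'j list set" where
  "words = {J. J \<noteq> []}"

definition word_root :: "'j list \<Rightarrow> 'j list set" where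
  "word_root J = {J' \<in> words. set J \<subseteq> set J'}"

text \<open>
  A family indexed by the open normal subgroups is a function on all subsets of the carrier,
  of which only the values at open normal subgroups matter. In a profinite group the number of
  cosets of an open subgroup is finite, so that \<open>card (rcosets\<^bsub>G\<^esub> N1)\<close> is the index of \<open>N1\<close>.
\<close>

definition sorting_data ::
    "(nat \<times> 'j list \<Rightarrow> 'j list) \<Rightarrow> ('a, 'm) topgroup_scheme \<Rightarrow> ('a set \<Rightarrow> 'j list set) \<Rightarrow> bool" where
  "sorting_data Jsub G F \<longleftrightarrow>
     (\<forall>N \<in> open_normal_subgroups G. F N \<noteq> {} \<and> F N \<subseteq> words) \<and>
     F (carrier G) = words \<and>
     (\<forall>N \<in> open_normal_subgroups G. \<forall>J \<in> words. J \<in> F N \<longleftrightarrow> word_root J \<subseteq> F N) \<and>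
     (\<forall>N1 \<in> open_normal_subgroups G. \<forall>N2 \<in> open_normal_subgroups G. \<forall>k \<ge> 1. \<forall>J.
        N1 \<subseteq> N2 \<longrightarrow> card (rcosets\<^bsub>G\<^esub> N1) \<le> k \<longrightarrow> J \<in> F N1 \<longrightarrow> Jsub (k, J) \<in> F N2) \<and>
     (\<forall>N1 \<in> open_normal_subgroups G. \<forall>N2 \<in> open_normal_subgroups G. \<forall>J1 J2.
        J1 \<in> F N1 \<longrightarrow> J2 \<in> F N2 \<longrightarrow> J1 @ J2 \<in> F (N1 \<inter> N2))"

definition sorted_profinite_group ::
    "(nat \<times> 'j list \<Rightarrow> 'j list) \<Rightarrow> ('a, 'm) topgroup_scheme \<Rightarrow> ('a set \<Rightarrow> 'j list set) \<Rightarrow> bool" where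
  "sorted_profinite_group Jsub G F \<longleftrightarrow> profinite_group G \<and> sorting_data Jsub G F"

definition sorted_morphisms ::
    "('a, 'm) topgroup_scheme \<Rightarrow> ('a set \<Rightarrow> 'j list set) \<Rightarrow>
     ('b, 'n) topgroup_scheme \<Rightarrow> ('b set \<Rightarrow> 'j list set) \<Rightarrow> ('a \<Rightarrow> 'b) set" where
  "sorted_morphisms G1 F1 G2 F2 =
     {f \<in> continuous_epi G1 G2.
        \<forall>N \<in> open_normal_subgroups G2. F2 N \<subseteq> F1 {x \<in> carrier G1. f x \<in> N}}"

text \<open>
  The intersection of the generating family is taken inside the carrier: the empty family has
  intersection \<open>carrier G\<close>, not \<open>UNIV\<close>.
\<close>

definition finitely_generated_sorting ::
    "(nat \<times> 'j list \<Rightarrow> 'j list) \<Rightarrow> ('a, 'm) topgroup_scheme \<Rightarrow> ('a set \<Rightarrow> 'j list set) \<Rightarrow> bool" where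
  "finitely_generated_sorting Jsub G F \<longleftrightarrow>
     (\<exists>X FX. X \<subseteq> open_normal_subgroups G \<and> carrier G \<inter> \<Inter>X = {\<one>\<^bsub>G\<^esub>} \<and>
        (\<forall>N \<in> X. FX N \<noteq> {} \<and> finite (FX N) \<and> FX N \<subseteq> words) \<and>
        sorting_data Jsub G F \<and> (\<forall>N \<in> X. FX N \<subseteq> F N) \<and>
        (\<forall>F'. sorting_data Jsub G F' \<and> (\<forall>N \<in> X. FX N \<subseteq> F' N) \<longrightarrow>
              (\<forall>N \<in> open_normal_subgroups G. F N \<subseteq> F' N)))"


section \<open>Finite quotients and embedding properties\<close>

text \<open>
  Isomorphism classes of finite groups are given by their members whose carrier is a set of
  natural numbers: every finite sorted profinite group is isomorphic to such a one, by
  transport along an injection into \<open>nat\<close>. \<open>SIm\<close>, \<open>FSIm\<close> and \<open>finite_images\<close> contain all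
  representatives of this kind, so quantifying over them is quantifying over the isomorphism
  classes together with every choice of representatives. The topology of a finite quotient is
  necessarily discrete, being that of a finite Hausdorff space.
\<close>

definition SIm ::
    "(nat \<times> 'j list \<Rightarrow> 'j list) \<Rightarrow> ('a, 'm) topgroup_scheme \<Rightarrow> ('a set \<Rightarrow> 'j list set) \<Rightarrow>
     (nat topgroup \<times> (nat set \<Rightarrow> 'j list set)) set" where
  "SIm Jsub G F =
     {(A, FA). sorted_profinite_group Jsub A FA \<and> finite (carrier A) \<and>
               sorted_morphisms G F A FA \<noteq> {}}"

definition FSIm ::
    "(nat \<times> 'j list \<Rightarrow> 'j list) \<Rightarrow> ('a, 'm) topgroup_scheme \<Rightarrow> ('a set \<Rightarrow> 'j list set) \<Rightarrow>
     (nat topgroup \<times> (nat set \<Rightarrow> 'j list set)) set" where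
  "FSIm Jsub G F = {(A, FA) \<in> SIm Jsub G F. finitely_generated_sorting Jsub A FA}"

definition SEP ::
    "(nat \<times> 'j list \<Rightarrow> 'j list) \<Rightarrow> ('a, 'm) topgroup_scheme \<Rightarrow> ('a set \<Rightarrow> 'j list set) \<Rightarrow> bool" where
  "SEP Jsub G F \<longleftrightarrow>
     (\<forall>(A, FA) \<in> SIm Jsub G F. \<forall>(B, FB) \<in> SIm Jsub G F.
        \<forall>\<pi> \<in> sorted_morphisms A FA B FB. \<forall>\<phi> \<in> sorted_morphisms G F B FB.
          \<exists>\<psi> \<in> sorted_morphisms G F A FA. \<forall>x \<in> carrier G. \<pi> (\<psi> x) = \<phi> x)"

definition FSEP ::
    "(nat \<times> 'j list \<Rightarrow> 'j list) \<Rightarrow> ('a, 'm) topgroup_scheme \<Rightarrow> ('a set \<Rightarrow> 'j list set) \<Rightarrow> bool" where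
  "FSEP Jsub G F \<longleftrightarrow>
     (\<forall>(A, FA) \<in> FSIm Jsub G F. \<forall>(B, FB) \<in> FSIm Jsub G F.
        \<forall>\<pi> \<in> sorted_morphisms A FA B FB. \<forall>\<phi> \<in> sorted_morphisms G F B FB.
          \<exists>\<psi> \<in> sorted_morphisms G F A FA. \<forall>x \<in> carrier G. \<pi> (\<psi> x) = \<phi> x)"

definition finite_images :: "('a, 'm) topgroup_scheme \<Rightarrow> nat topgroup set" where
  "finite_images G = {A. profinite_group A \<and> finite (carrier A) \<and> continuous_epi G A \<noteq> {}}"

definition EP :: "('a, 'm) topgroup_scheme \<Rightarrow> bool" where
  "EP G \<longleftrightarrow>
     (\<forall>A \<in> finite_images G. \<forall>B \<in> finite_images G.
        \<forall>\<pi> \<in> continuous_epi A B. \<forall>\<phi> \<in> continuous_epi G B.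
          \<exists>\<psi> \<in> continuous_epi G A. \<forall>x \<in> carrier G. \<pi> (\<psi> x) = \<phi> x)"

end

theory Submission
  imports Defs "HOL-Algebra.Weak_Morphisms"
begin

text \<open>
  The only real step is to pass from FSEP to (3). Given \<open>\<theta> : G \<rightarrow> A\<close> with \<open>A\<close> finite and a word \<open>J\<close> in
  \<open>F (ker \<theta>)\<close>, the least sorting data on \<open>A\<close> with \<open>J\<close> at the trivial subgroup is finitely generated
  and makes \<open>\<theta>\<close> a morphism, since \<open>N \<mapsto> F (\<theta>\<^sup>-\<^sup>1 N)\<close> is itself sorting data on \<open>A\<close>. If moreover
  \<open>\<pi> : A \<rightarrow> B\<close> and \<open>\<phi> : G \<rightarrow> B\<close> are epimorphisms, then a word sorted at both kernels, placed at
  the trivial subgroup of \<open>B\<close>, makes \<open>\<pi>\<close> and \<open>\<phi>\<close> morphisms, so FSEP yields \<open>\<psi>\<close> with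
  \<open>\<pi> \<circ> \<psi> = \<phi>\<close> and \<open>J \<in> F (ker \<psi>)\<close>. This contains EP, and for \<open>A = B = G/N \<cong> G/N'\<close> with \<open>\<pi> = id\<close>
  and \<open>\<phi>\<close> of kernel \<open>N'\<close> it shows \<open>F N \<subseteq> F N'\<close>.
\<close>

section \<open>Preimages of open normal subgroups\<close>

text \<open>The composite of \<open>f\<close> with the projection onto \<open>H Mod N\<close> has
  the preimage of \<open>N\<close> as its kernel. This one map yields both the normality of the
  preimage and, by the first isomorphism theorem, its quotient.\<close>

lemma
  assumes "group G" "group H" and f: "f \<in> hom G H" and N: "N \<lhd> H"
  shows group_hom_to_FactGroup: "group_hom G (H Mod N) (\<lambda>x. N #>\<^bsub>H\<^esub> f x)"
    and kernel_to_FactGroup: "kernel G (H Mod N) (\<lambda>x. N #>\<^bsub>H\<^esub> f x) = {x \<in> carrier G. f x \<in> N}"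
proof -
  interpret H: group H by fact
  interpret N: normal N H by fact
  have "(\<lambda>x. N #>\<^bsub>H\<^esub> f x) \<in> hom G (H Mod N)"
    using Group.hom_compose[OF f N.r_coset_hom_Mod] by (simp add: o_def)
  thus "group_hom G (H Mod N) (\<lambda>x. N #>\<^bsub>H\<^esub> f x)"
    using assms(1) N.factorgroup_is_group by (simp add: group_hom_def group_hom_axioms_def)
  have "N #>\<^bsub>H\<^esub> f x = N \<longleftrightarrow> f x \<in> N" if "x \<in> carrier G" for x
    using H.coset_join1 H.coset_join2 hom_in_carrier[OF f that] N.is_subgroup by blast
  thus "kernel G (H Mod N) (\<lambda>x. N #>\<^bsub>H\<^esub> f x) = {x \<in> carrier G. f x \<in> N}"
    by (auto simp: kernel_def)
qed

lemma normal_vimage: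
  assumes "group G" "group H" "f \<in> hom G H" "N \<lhd> H"
  shows "{x \<in> carrier G. f x \<in> N} \<lhd> G"
  using group_hom.normal_kernel[OF group_hom_to_FactGroup[OF assms]]
  by (simp add: kernel_to_FactGroup[OF assms])

lemma epi_FactGroup_iso:
  assumes "group G" "group H" and f: "f \<in> epi G H" and N: "N \<lhd> H"
  shows "(G Mod {x \<in> carrier G. f x \<in> N}) \<cong> (H Mod N)"
proof -
  have f': "f \<in> hom G H" "f ` carrier G = carrier H"
    using f by (auto simp: epi_def)
  have "(\<lambda>x. N #>\<^bsub>H\<^esub> f x) ` carrier G = carrier (H Mod N)"
    unfolding carrier_FactGroup f'(2)[symmetric] image_image ..
  from group_hom.FactGroup_iso[OF group_hom_to_FactGroup[OF assms(1,2) f'(1) N] this]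
  show ?thesis
    by (simp add: kernel_to_FactGroup[OF assms(1,2) f'(1) N])
qed

lemma iso_imp_card_rcosets_eq:
  assumes "(G Mod M) \<cong> (H Mod N)"
  shows "card (rcosets\<^bsub>G\<^esub> M) = card (rcosets\<^bsub>H\<^esub> N)"
proof -
  from assms obtain h where "h \<in> iso (G Mod M) (H Mod N)"
    by (auto simp: is_iso_def)
  thus ?thesis
    by (auto simp: iso_def FactGroup_def dest: bij_betw_same_card)
qed

lemma open_normal_subgroup_vimage:
  assumes "topological_group G" "topological_group H"
    and f: "f \<in> continuous_epi G H" and N: "N \<in> open_normal_subgroups H"
  shows "{x \<in> carrier G. f x \<in> N} \<in> open_normal_subgroups G"
proof -
  interpret G: topological_group G by fact
  interpret H: topological_group H by fact
  have "{x \<in> carrier G. f x \<in> N} \<lhd> G"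
    using normal_vimage[OF G.is_group H.is_group] f N
    by (simp add: open_normal_subgroups_def continuous_epi_def epi_def)
  moreover have "openin (group_topology G) {x \<in> topspace (group_topology G). f x \<in> N}"
    using f N by (auto simp: continuous_epi_def open_normal_subgroups_def
        intro: openin_continuous_map_preimage)
  ultimately show ?thesis
    by (simp add: open_normal_subgroups_def G.topspace_eq)
qed

lemma continuous_epi_FactGroup_iso:
  assumes "topological_group G" "topological_group H"
    and "f \<in> continuous_epi G H" and "N \<in> open_normal_subgroups H"
  shows "(G Mod {x \<in> carrier G. f x \<in> N}) \<cong> (H Mod N)"
  using assms epi_FactGroup_iso[of G H f N]
  by (simp add: topological_group_def continuous_epi_def open_normal_subgroups_def)

section \<open>Finite quotients\<close>

lemma (in profinite_group) finite_imp_discrete: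
  assumes "finite (carrier G)"
  shows "group_topology G = discrete_topology (carrier G)"
  using Hausdorff assms topspace_eq
  by (metis Hausdorff_imp_t1_space finite_t1_space_imp_discrete_topology)

text \<open>In a finite quotient this is the least open normal subgroup, and its preimage under a
  homomorphism is the kernel; generating words will be placed there.\<close>

lemma (in profinite_group) one_open_normal:
  assumes "finite (carrier G)"
  shows "{\<one>} \<in> open_normal_subgroups G"
  using finite_imp_discrete[OF assms] one_is_normal
  by (simp add: open_normal_subgroups_def)

section \<open>Open cosets and finiteness of the index\<close>

text \<open>The coset is the preimage of \<open>N\<close> under right translation by
  \<open>inv x\<close>, which is continuous.\<close>

lemma (in topological_group) openin_r_coset:
  assumes "openin (group_topology G) N" "N \<subseteq> carrier G" "x \<in> carrier G"
  shows "openin (group_topology G) (N #> x)"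
proof -
  have "continuous_map (group_topology G) (prod_topology (group_topology G) (group_topology G))
          (\<lambda>y. (y, inv x))"
    using assms(3) by (intro continuous_map_pairedI) (auto simp: topspace_eq)
  hence "continuous_map (group_topology G) (group_topology G) (\<lambda>y. y \<otimes> inv x)"
    using continuous_map_compose[OF _ continuous_mult] by (force simp: o_def)
  hence "openin (group_topology G) {y \<in> carrier G. y \<otimes> inv x \<in> N}"
    using assms(1) openin_continuous_map_preimage topspace_eq by fastforce
  moreover have "{y \<in> carrier G. y \<otimes> inv x \<in> N} = N #> x"
  proof -
    have "y \<in> N #> x" if "y \<in> carrier G" "y \<otimes> inv x \<in> N" for y
      using that assms by (auto simp: r_coset_def m_assoc intro!: bexI[of _ "y \<otimes> inv x"])
    moreover have "y \<otimes> x \<otimes> inv x = y" if "y \<in> N" for y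
      using that assms by (metis in_mono inv_solve_right m_closed)
    ultimately show ?thesis
      using assms by (auto simp: r_coset_def)
  qed
  ultimately show ?thesis by simp
qed

text \<open>The cosets of \<open>N\<close> form an open cover, so finitely many of them cover
  \<open>G\<close>. As they are non-empty and pairwise disjoint, no coset can be missing from the
  subcover.\<close>

lemma (in profinite_group) finite_rcosets:
  assumes "N \<in> open_normal_subgroups G"
  shows "finite (rcosets N)"
proof -
  interpret N: normal N G
    using assms by (simp add: open_normal_subgroups_def)
  have "openin (group_topology G) U" if "U \<in> rcosets N" for U
    using that assms openin_r_coset N.subset
    by (auto simp: RCOSETS_def open_normal_subgroups_def)
  moreover have U: "\<Union>(rcosets N) = carrier G"
    by (rule rcosets_part_G[OF N.is_subgroup])
  ultimately obtain \<F> where \<F>: "finite \<F>" "\<F> \<subseteq> rcosets N" "carrier G \<subseteq> \<Union>\<F>"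
    using compact unfolding compact_space_alt topspace_eq by (metis order_refl)
  have "U \<in> \<F>" if mem: "U \<in> rcosets N" for U
  proof -
    obtain x where x: "x \<in> U"
      using N.rcosets_non_empty[OF mem] by blast
    have "U \<subseteq> carrier G"
      using U mem by blast
    then obtain V where V: "V \<in> \<F>" "x \<in> V"
      using \<F>(3) x by blast
    hence "U = V"
      using rcos_disjoint[OF N.is_subgroup] mem x \<F>(2)
      unfolding pairwise_def disjnt_def by blast
    thus ?thesis using V by simp
  qed
  thus ?thesis
    using finite_subset[OF subsetI \<F>(1)] by simp
qed

section \<open>Copies of finite quotients on natural numbers\<close>

text \<open>The embedding properties quantify over finite groups carried by sets of natural numbers,
  so a quotient of \<open>G\<close> has to be transported there before they apply.\<close>

lemma nat_copy_of_finite_group: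
  assumes "group H" "finite (carrier H)"
  obtains A :: "nat topgroup" where "profinite_group A" "finite (carrier A)" "H \<cong> A"
proof -
  interpret H: group H by fact
  obtain e :: "'a \<Rightarrow> nat" where e: "inj_on e (carrier H)"
    using assms(2) finite_imp_inj_to_nat_seg by metis
  define M where "M = image_group e H"
  \<comment> \<open>The transported record has no topology yet; the extension supplies the discrete
    one.\<close>
  define A :: "nat topgroup"
    where "A = monoid.extend M \<lparr>group_topology = discrete_topology (carrier M)\<rparr>"
  have A: "carrier A = carrier M" "monoid.mult A = monoid.mult M" "one A = one M"
    "group_topology A = discrete_topology (carrier M)"
    by (simp_all add: A_def monoid.defs)
  have M: "group M" "e \<in> iso H M"
    unfolding M_def using H.inj_imp_image_group_is_group[OF e] inj_imp_image_group_iso[OF e]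
    by auto
  have fin: "finite (carrier M)"
    using assms(2) by (simp add: M_def image_group_carrier)
  have "e \<in> iso H A"
    using M(2) by (simp add: iso_def hom_def A)
  interpret M: group M by (rule M(1))
  interpret A: group A
    by (rule groupI) (simp_all add: A M.m_assoc M.l_inv_ex)
  have "profinite_group A"
  proof
    show "continuous_map (prod_topology (group_topology A) (group_topology A)) (group_topology A)
           (\<lambda>(x, y). x \<otimes>\<^bsub>A\<^esub> y)"
      by (simp add: A flip: prod_topology_discrete_topology) (use A.m_closed A in auto)
    show "continuous_map (group_topology A) (group_topology A) (\<lambda>x. inv\<^bsub>A\<^esub> x)"
      using A.inv_closed by (auto simp: A)
    fix S assume "connectedin (group_topology A) S"
    thus "\<exists>a. S \<subseteq> {a}"
      by (auto simp: A connectedin_discrete_topology)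
  qed (auto simp: A compact_space_discrete_topology fin)
  thus ?thesis
    using that[of A] fin A(1) \<open>e \<in> iso H A\<close> by (auto simp: is_iso_def)
qed

text \<open>Projecting onto \<open>G Mod N\<close> and then applying the isomorphism realises a
  prescribed \<open>N\<close> as the kernel of a continuous map onto a given copy of its
  quotient.\<close>

lemma quotient_epi_exists:
  assumes "topological_group G" and N: "N \<in> open_normal_subgroups G"
    and "profinite_group A" "finite (carrier A)" and "(G Mod N) \<cong> A"
  obtains q where "q \<in> continuous_epi G A" "{x \<in> carrier G. q x \<in> {\<one>\<^bsub>A\<^esub>}} = N"
proof -
  interpret G: topological_group G by fact
  interpret A: profinite_group A by fact
  interpret N: normal N G
    using N by (simp add: open_normal_subgroups_def)
  obtain h where h: "h \<in> iso (G Mod N) A"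
    using assms(5) by (auto simp: is_iso_def)
  define q where "q = (\<lambda>x. h (N #>\<^bsub>G\<^esub> x))"
  have q_hom: "q \<in> hom G A"
    using Group.hom_compose[OF N.r_coset_hom_Mod, of h A] h by (simp add: iso_def q_def o_def)
  have q_epi: "q ` carrier G = carrier A"
    using h by (auto simp: iso_def bij_betw_def q_def carrier_FactGroup image_image)
  have inj: "inj_on h ((#>\<^bsub>G\<^esub>) N ` carrier G)"
    using h by (simp add: iso_def bij_betw_def carrier_FactGroup)
  have cong: "q y = q x" if "y \<in> N #>\<^bsub>G\<^esub> x" "x \<in> carrier G" for x y
    using G.repr_independence[OF that N.is_subgroup] by (simp add: q_def)
  \<comment> \<open>\<open>U\<close> is arbitrary: \<open>q\<close> is constant on the cosets of
    \<open>N\<close>, which are open, so every preimage is a union of open cosets.\<close>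
  have "openin (group_topology G) {x \<in> carrier G. q x \<in> U}" for U
  proof (subst openin_subopen, intro ballI)
    fix x assume x: "x \<in> {x \<in> carrier G. q x \<in> U}"
    hence "openin (group_topology G) (N #>\<^bsub>G\<^esub> x)"
      using G.openin_r_coset N N.subset by (auto simp: open_normal_subgroups_def)
    moreover have "x \<in> N #>\<^bsub>G\<^esub> x"
      using x G.rcos_self[OF _ N.is_subgroup] by auto
    moreover have "N #>\<^bsub>G\<^esub> x \<subseteq> {x \<in> carrier G. q x \<in> U}"
      using x cong G.r_coset_subset_G[OF N.subset] by auto
    ultimately show "\<exists>T. openin (group_topology G) T \<and> x \<in> T \<and> T \<subseteq> {x \<in> carrier G. q x \<in> U}"
      by blast
  qed
  hence "continuous_map (group_topology G) (group_topology A) q"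
    using q_epi by (auto simp: continuous_map_def G.topspace_eq A.topspace_eq)
  hence 1: "q \<in> continuous_epi G A"
    using q_hom q_epi by (simp add: continuous_epi_def epi_def)
  have q1: "q \<one>\<^bsub>G\<^esub> = \<one>\<^bsub>A\<^esub>"
    using q_hom hom_one G.is_group A.is_group by blast
  have "q x = \<one>\<^bsub>A\<^esub> \<longleftrightarrow> x \<in> N" if x: "x \<in> carrier G" for x
  proof -
    have "q x = q \<one>\<^bsub>G\<^esub> \<longleftrightarrow> N #>\<^bsub>G\<^esub> x = N #>\<^bsub>G\<^esub> \<one>\<^bsub>G\<^esub>"
      unfolding q_def using x inj by (intro inj_on_eq_iff) auto
    also have "\<dots> \<longleftrightarrow> x \<in> N"
      using G.coset_join1[OF _ x N.is_subgroup] G.coset_join2[OF x N.is_subgroup] N.subset by auto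
    finally show ?thesis by (simp add: q1)
  qed
  hence "{x \<in> carrier G. q x \<in> {\<one>\<^bsub>A\<^esub>}} = N"
    using N.subset by auto
  thus ?thesis using that 1 by blast
qed


section \<open>Sorting data\<close>

lemma
  assumes "sorting_data Jsub G F"
  shows sorting_data_nonempty: "N \<in> open_normal_subgroups G \<Longrightarrow> F N \<noteq> {}"
    and sorting_data_words: "N \<in> open_normal_subgroups G \<Longrightarrow> J \<in> F N \<Longrightarrow> J \<in> words"
    and sorting_data_carrier: "F (carrier G) = words"
    and sorting_data_mono: "\<lbrakk>N \<in> open_normal_subgroups G; J \<in> F N; set J \<subseteq> set J'; J' \<in> words\<rbrakk>
      \<Longrightarrow> J' \<in> F N"
    and sorting_data_Jsub: "\<lbrakk>N1 \<in> open_normal_subgroups G; N2 \<in> open_normal_subgroups G;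
      N1 \<subseteq> N2; card (rcosets\<^bsub>G\<^esub> N1) \<le> k; 1 \<le> k; J \<in> F N1\<rbrakk> \<Longrightarrow> Jsub (k, J) \<in> F N2"
    and sorting_data_append: "\<lbrakk>N1 \<in> open_normal_subgroups G; N2 \<in> open_normal_subgroups G;
      J1 \<in> F N1; J2 \<in> F N2\<rbrakk> \<Longrightarrow> J1 @ J2 \<in> F (N1 \<inter> N2)"
proof -
  note F = assms[unfolded sorting_data_def]
  note F1 = F[THEN conjunct1]
    and F2 = F[THEN conjunct2, THEN conjunct1]
    and F3 = F[THEN conjunct2, THEN conjunct2, THEN conjunct1]
    and F4 = F[THEN conjunct2, THEN conjunct2, THEN conjunct2, THEN conjunct1]
    and F5 = F[THEN conjunct2, THEN conjunct2, THEN conjunct2, THEN conjunct2]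
  show "F N \<noteq> {}" if "N \<in> open_normal_subgroups G"
    using F1 that by blast
  show words: "J \<in> words" if "N \<in> open_normal_subgroups G" "J \<in> F N" for N J
    using F1 that by blast
  show "F (carrier G) = words"
    by (rule F2)
  show "J' \<in> F N"
    if "N \<in> open_normal_subgroups G" "J \<in> F N" "set J \<subseteq> set J'" "J' \<in> words"
  proof -
    have "word_root J \<subseteq> F N"
      using F3 that words by blast
    thus ?thesis
      using that by (auto simp: word_root_def)
  qed
  show "Jsub (k, J) \<in> F N2"
    if "N1 \<in> open_normal_subgroups G" "N2 \<in> open_normal_subgroups G"
      "N1 \<subseteq> N2" "card (rcosets\<^bsub>G\<^esub> N1) \<le> k" "1 \<le> k" "J \<in> F N1"
    using F4 that by blast
  show "J1 @ J2 \<in> F (N1 \<inter> N2)"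
    if "N1 \<in> open_normal_subgroups G" "N2 \<in> open_normal_subgroups G" "J1 \<in> F N1" "J2 \<in> F N2"
    using F5 that by blast
qed

text \<open>Upward closure under inclusion of supports suffices for the equivalence (ii), because a
  non-empty word belongs to its own root.\<close>

lemma sorting_dataI:
  assumes "\<And>N. N \<in> open_normal_subgroups G \<Longrightarrow> F N \<noteq> {}"
    and "\<And>N J. N \<in> open_normal_subgroups G \<Longrightarrow> J \<in> F N \<Longrightarrow> J \<in> words"
    and "F (carrier G) = words"
    and "\<And>N J J'. \<lbrakk>N \<in> open_normal_subgroups G; J \<in> F N; set J \<subseteq> set J'; J' \<in> words\<rbrakk> \<Longrightarrow> J' \<in> F N"
    and "\<And>N1 N2 k J. \<lbrakk>N1 \<in> open_normal_subgroups G; N2 \<in> open_normal_subgroups G;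
      N1 \<subseteq> N2; card (rcosets\<^bsub>G\<^esub> N1) \<le> k; 1 \<le> k; J \<in> F N1\<rbrakk> \<Longrightarrow> Jsub (k, J) \<in> F N2"
    and "\<And>N1 N2 J1 J2. \<lbrakk>N1 \<in> open_normal_subgroups G; N2 \<in> open_normal_subgroups G;
      J1 \<in> F N1; J2 \<in> F N2\<rbrakk> \<Longrightarrow> J1 @ J2 \<in> F (N1 \<inter> N2)"
  shows "sorting_data Jsub G F"
proof -
  have iff: "J \<in> F N \<longleftrightarrow> word_root J \<subseteq> F N" if "N \<in> open_normal_subgroups G" "J \<in> words" for N J
    using that assms(4)[OF that(1)] by (auto simp: word_root_def)
  show ?thesis
    unfolding sorting_data_def
  proof (intro conjI ballI allI impI)
    show "F N \<subseteq> words" if "N \<in> open_normal_subgroups G" for N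
      using assms(2)[OF that] by blast
  qed (rule assms(1,3,5,6) iff; assumption)+
qed

text \<open>Taking preimages preserves inclusions, intersections and indices, so each condition is
  inherited from \<open>G\<close>. Sorting data on \<open>B\<close> makes \<open>f\<close> a
  morphism exactly when it lies below this one at every open normal subgroup.\<close>

lemma sorting_data_push_forward:
  assumes G: "topological_group G" and B: "topological_group B"
    and f: "f \<in> continuous_epi G B" and F: "sorting_data Jsub G F"
  shows "sorting_data Jsub B (\<lambda>N. F {x \<in> carrier G. f x \<in> N})"
proof -
  let ?v = "\<lambda>N. {x \<in> carrier G. f x \<in> N}"
  have v: "?v N \<in> open_normal_subgroups G" if "N \<in> open_normal_subgroups B" for N
    using open_normal_subgroup_vimage[OF G B f that] .
  have carrier: "?v (carrier B) = carrier G"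
    using f by (auto simp: continuous_epi_def epi_def)
  have card: "card (rcosets\<^bsub>G\<^esub> (?v N)) = card (rcosets\<^bsub>B\<^esub> N)"
    if "N \<in> open_normal_subgroups B" for N
    using continuous_epi_FactGroup_iso[OF G B f that] by (rule iso_imp_card_rcosets_eq)
  have Int: "?v (M \<inter> N) = ?v M \<inter> ?v N" for M N
    by blast
  show ?thesis
  proof (rule sorting_dataI)
    fix N1 N2 k J
    assume *: "N1 \<in> open_normal_subgroups B" "N2 \<in> open_normal_subgroups B" "N1 \<subseteq> N2"
      "card (rcosets\<^bsub>B\<^esub> N1) \<le> k" "1 \<le> k" "J \<in> F (?v N1)"
    show "Jsub (k, J) \<in> F (?v N2)"
      using * by (intro sorting_data_Jsub[OF F v[OF *(1)] v[OF *(2)]]) (auto simp: card)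
  next
    fix N1 N2 J1 J2
    assume *: "N1 \<in> open_normal_subgroups B" "N2 \<in> open_normal_subgroups B"
      "J1 \<in> F (?v N1)" "J2 \<in> F (?v N2)"
    show "J1 @ J2 \<in> F (?v (N1 \<inter> N2))"
      unfolding Int using sorting_data_append[OF F v[OF *(1)] v[OF *(2)] *(3,4)] .
  next
    show "F (?v (carrier B)) = words"
      using carrier sorting_data_carrier[OF F] by simp
  qed (fact sorting_data_nonempty[OF F v] sorting_data_words[OF F v] sorting_data_mono[OF F v])+
qed

section \<open>Sorting data generated by one word\<close>

text \<open>Generation is expressed as an intersection from above. With no competing
  \<open>F\<close> the intersection is \<open>UNIV\<close>, so this is shown to be sorting data only
  when one competitor is given.\<close>

definition principal_sorting ::
    "(nat \<times> 'j list \<Rightarrow> 'j list) \<Rightarrow> ('a, 'm) topgroup_scheme \<Rightarrow> 'j list \<Rightarrow> 'a set \<Rightarrow> 'j list set" where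
  "principal_sorting Jsub A J N = \<Inter>{F N |F. sorting_data Jsub A F \<and> J \<in> F {\<one>\<^bsub>A\<^esub>}}"

lemma principal_sorting_least:
  assumes "sorting_data Jsub A F" "J \<in> F {\<one>\<^bsub>A\<^esub>}"
  shows "principal_sorting Jsub A J N \<subseteq> F N"
  using assms by (auto simp: principal_sorting_def)

lemma mem_principal_sorting: "J \<in> principal_sorting Jsub A J {\<one>\<^bsub>A\<^esub>}"
  by (auto simp: principal_sorting_def)

text \<open>An intersection of non-empty sets may be empty. Here condition (iii), applied to the
  inclusion of the trivial subgroup in \<open>N\<close>, puts one and the same word into every
  competitor.\<close>

lemma Jsub_mem_principal_sorting:
  assumes "profinite_group A" "finite (carrier A)" and N: "N \<in> open_normal_subgroups A"
  obtains k where "Jsub (k, J) \<in> principal_sorting Jsub A J N"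
proof
  interpret A: profinite_group A by fact
  \<comment> \<open>The successor makes the bound positive, as condition (iii) requires.\<close>
  let ?k = "Suc (card (rcosets\<^bsub>A\<^esub> {\<one>\<^bsub>A\<^esub>}))"
  have "{\<one>\<^bsub>A\<^esub>} \<in> open_normal_subgroups A"
    by (rule A.one_open_normal) fact
  moreover have "{\<one>\<^bsub>A\<^esub>} \<subseteq> N"
    using N by (auto simp: open_normal_subgroups_def normal_def subgroup.one_closed)
  moreover have "?k \<ge> 1" "card (rcosets\<^bsub>A\<^esub> {\<one>\<^bsub>A\<^esub>}) \<le> ?k"
    by simp_all
  ultimately have "Jsub (?k, J) \<in> F N" if "sorting_data Jsub A F" "J \<in> F {\<one>\<^bsub>A\<^esub>}" for F
    using that N sorting_data_Jsub[of Jsub A F] by blast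
  thus "Jsub (?k, J) \<in> principal_sorting Jsub A J N"
    by (auto simp: principal_sorting_def)
qed

text \<open>The closure conditions pass to intersections; non-emptiness does not, and comes from the
  word supplied by \<open>Jsub\<close>. The competitor \<open>F0\<close> keeps the intersection
  inside \<open>words\<close>.\<close>

lemma sorting_data_principal_sorting:
  assumes A: "profinite_group A" "finite (carrier A)"
    and ex: "sorting_data Jsub A F0" "J \<in> F0 {\<one>\<^bsub>A\<^esub>}"
  shows "sorting_data Jsub A (principal_sorting Jsub A J)"
proof -
  let ?P = "principal_sorting Jsub A J"
  have mem: "K \<in> ?P N \<longleftrightarrow> (\<forall>F. sorting_data Jsub A F \<and> J \<in> F {\<one>\<^bsub>A\<^esub>} \<longrightarrow> K \<in> F N)" for K N
    by (auto simp: principal_sorting_def)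
  note P_least = principal_sorting_least[of Jsub A F0 J, OF ex]
  show ?thesis
  proof (rule sorting_dataI)
    show "?P N \<noteq> {}" if "N \<in> open_normal_subgroups A" for N
      using Jsub_mem_principal_sorting[OF A that] by blast
    show "K \<in> words" if "N \<in> open_normal_subgroups A" "K \<in> ?P N" for N K
      using sorting_data_words[OF ex(1) that(1)] P_least that(2) by blast
    show "?P (carrier A) = words"
      using P_least[of "carrier A"] sorting_data_carrier[OF ex(1)]
      by (auto simp: mem sorting_data_carrier)
    show "K' \<in> ?P N"
      if "N \<in> open_normal_subgroups A" "K \<in> ?P N" "set K \<subseteq> set K'" "K' \<in> words" for N K K'
      using that(2) sorting_data_mono[OF _ that(1) _ that(3,4)] unfolding mem by blast
    show "Jsub (k, K) \<in> ?P N2"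
      if "N1 \<in> open_normal_subgroups A" "N2 \<in> open_normal_subgroups A" "N1 \<subseteq> N2"
        "card (rcosets\<^bsub>A\<^esub> N1) \<le> k" "1 \<le> k" "K \<in> ?P N1" for N1 N2 k K
      using that(6) sorting_data_Jsub[OF _ that(1-5)] unfolding mem by blast
    show "J1 @ J2 \<in> ?P (N1 \<inter> N2)"
      if "N1 \<in> open_normal_subgroups A" "N2 \<in> open_normal_subgroups A" "J1 \<in> ?P N1" "J2 \<in> ?P N2"
      for N1 N2 J1 J2
      using that(3,4) sorting_data_append[OF _ that(1,2)] unfolding mem by blast
  qed
qed

lemma principal_sorting_FSIm:
  assumes GF: "sorted_profinite_group Jsub G F"
    and A: "profinite_group A" "finite (carrier A)"
    and f: "f \<in> continuous_epi G A"
    and J: "J \<in> F {x \<in> carrier G. f x \<in> {\<one>\<^bsub>A\<^esub>}}"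
  shows "f \<in> sorted_morphisms G F A (principal_sorting Jsub A J)"
    and "(A, principal_sorting Jsub A J) \<in> FSIm Jsub G F"
proof -
  interpret A: profinite_group A by fact
  interpret G: profinite_group G
    using GF by (simp add: sorted_profinite_group_def)
  let ?P = "principal_sorting Jsub A J"
  have push: "sorting_data Jsub A (\<lambda>N. F {x \<in> carrier G. f x \<in> N})"
    using sorting_data_push_forward[OF G.topological_group_axioms A.topological_group_axioms f] GF
    unfolding sorted_profinite_group_def by blast
  have P: "sorting_data Jsub A ?P"
    by (rule sorting_data_principal_sorting[OF A push J])
  show mor: "f \<in> sorted_morphisms G F A ?P"
    using f principal_sorting_least[of Jsub A "\<lambda>N. F {x \<in> carrier G. f x \<in> N}" J, OF push J]
    by (simp add: sorted_morphisms_def)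
  have one: "{\<one>\<^bsub>A\<^esub>} \<in> open_normal_subgroups A"
    by (rule A.one_open_normal[OF A(2)])
  have "J \<in> words"
    using sorting_data_words[OF push one J] .
  \<comment> \<open>The only generator is \<open>J\<close>, placed at the trivial subgroup, which by
    itself already has trivial intersection; minimality is built into the intersection.\<close>
  hence "finitely_generated_sorting Jsub A ?P"
    unfolding finitely_generated_sorting_def
    using one P mem_principal_sorting[of J Jsub A] principal_sorting_least[of Jsub A]
    by (intro exI[of _ "{{\<one>\<^bsub>A\<^esub>}}"] exI[of _ "\<lambda>_. {J}"]) auto
  thus "(A, ?P) \<in> FSIm Jsub G F"
    using A P mor by (auto simp: FSIm_def SIm_def sorted_profinite_group_def)
qed

section \<open>The embedding properties\<close>

lemma FSEPD:
  assumes "FSEP Jsub G F" "(A, FA) \<in> FSIm Jsub G F" "(B, FB) \<in> FSIm Jsub G F"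
    and "\<pi> \<in> sorted_morphisms A FA B FB" "\<phi> \<in> sorted_morphisms G F B FB"
  shows "\<exists>\<psi>\<in>sorted_morphisms G F A FA. \<forall>x\<in>carrier G. \<pi> (\<psi> x) = \<phi> x"
  by (rule bspec[OF bspec[OF bspec[OF bspec[OF assms(1)[unfolded FSEP_def] assms(2),
      unfolded prod.case] assms(3), unfolded prod.case] assms(4)] assms(5)])

text \<open>FSEP speaks of sorted morphisms, whereas \<open>\<pi>\<close> and \<open>\<phi>\<close>
  are given as mere epimorphisms; sorting data on \<open>B\<close> is tailored to both. Since the
  lift is sorted, \<open>J\<close> also lies in \<open>F\<close> at its kernel.\<close>

lemma FSEP_lift:
  fixes A B :: "nat topgroup"
  assumes GF: "sorted_profinite_group Jsub G F" and FSEP: "FSEP Jsub G F"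
    and A: "profinite_group A" "finite (carrier A)" and B: "profinite_group B" "finite (carrier B)"
    and \<theta>: "\<theta> \<in> continuous_epi G A" and J: "J \<in> F {x \<in> carrier G. \<theta> x \<in> {\<one>\<^bsub>A\<^esub>}}"
    and \<pi>: "\<pi> \<in> continuous_epi A B" and \<phi>: "\<phi> \<in> continuous_epi G B"
  obtains \<psi> where "\<psi> \<in> sorted_morphisms G F A (principal_sorting Jsub A J)"
    "\<And>x. x \<in> carrier G \<Longrightarrow> \<pi> (\<psi> x) = \<phi> x"
proof -
  interpret A: profinite_group A by fact
  interpret B: profinite_group B by fact
  interpret G: profinite_group G
    using GF by (simp add: sorted_profinite_group_def)
  note top = G.topological_group_axioms A.topological_group_axioms B.topological_group_axioms
  have F: "sorting_data Jsub G F"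
    using GF by (simp add: sorted_profinite_group_def)
  let ?FA = "principal_sorting Jsub A J"
  let ?K\<pi> = "{x \<in> carrier A. \<pi> x \<in> {\<one>\<^bsub>B\<^esub>}}" and ?K\<phi> = "{x \<in> carrier G. \<phi> x \<in> {\<one>\<^bsub>B\<^esub>}}"
  have oneB: "{\<one>\<^bsub>B\<^esub>} \<in> open_normal_subgroups B"
    by (rule B.one_open_normal[OF B(2)])
  have K\<pi>: "?K\<pi> \<in> open_normal_subgroups A"
    by (rule open_normal_subgroup_vimage[OF top(2,3) \<pi> oneB])
  have K\<phi>: "?K\<phi> \<in> open_normal_subgroups G"
    by (rule open_normal_subgroup_vimage[OF top(1,3) \<phi> oneB])
  note A_FSIm = principal_sorting_FSIm(2)[where F = F, OF GF A \<theta> J]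
  hence FA: "sorting_data Jsub A ?FA"
    by (simp add: FSIm_def SIm_def sorted_profinite_group_def)
  obtain J1 where J1: "J1 \<in> ?FA ?K\<pi>"
    using sorting_data_nonempty[OF FA K\<pi>] by blast
  obtain J2 where J2: "J2 \<in> F ?K\<phi>"
    using sorting_data_nonempty[OF F K\<phi>] by blast
  \<comment> \<open>Words form a directed set under inclusion of supports, and sorting data are upward closed.\<close>
  have "J1 @ J2 \<in> words"
    using sorting_data_words[OF FA K\<pi> J1] by (auto simp: words_def)
  hence J12: "J1 @ J2 \<in> ?FA ?K\<pi>" "J1 @ J2 \<in> F ?K\<phi>"
    using sorting_data_mono[where F = ?FA, OF FA K\<pi> J1]
      sorting_data_mono[where F = F, OF F K\<phi> J2] by simp_all
  let ?FB = "principal_sorting Jsub B (J1 @ J2)"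
  have B_FSIm: "\<phi> \<in> sorted_morphisms G F B ?FB" "(B, ?FB) \<in> FSIm Jsub G F"
    using principal_sorting_FSIm[where F = F, OF GF B \<phi> J12(2)] by simp_all
  \<comment> \<open>\<open>A\<close> with \<open>?FA\<close> takes the place of the sorted group
    \<open>G\<close>, so the same criterion applies to \<open>\<pi>\<close>.\<close>
  have "\<pi> \<in> sorted_morphisms A ?FA B ?FB"
    using principal_sorting_FSIm(1)[where F = ?FA, OF _ B \<pi> J12(1)] A FA
    by (simp add: sorted_profinite_group_def)
  thus ?thesis
    using FSEPD[OF FSEP A_FSIm] B_FSIm that by blast
qed

section \<open>Implications between the three conditions\<close>

lemma SEP_imp_FSEP:
  assumes "SEP Jsub G F"
  shows "FSEP Jsub G F"
proof -
  have "FSIm Jsub G F \<subseteq> SIm Jsub G F"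
    by (auto simp: FSIm_def)
  note FSIm_SIm = subsetD[OF this]
  note SEP = assms[unfolded SEP_def split_def]
  show ?thesis
    unfolding FSEP_def split_def
    by (intro ballI)
      (rule bspec[OF bspec[OF bspec[OF bspec[OF SEP FSIm_SIm] FSIm_SIm]]]; assumption)
qed

text \<open>EP carries no sorting, so any word from \<open>F\<close> at the kernel of some
  epimorphism onto \<open>A\<close> may generate the data; the lift is then kept as a plain
  epimorphism.\<close>

lemma FSEP_imp_EP:
  assumes GF: "sorted_profinite_group Jsub G F" and FSEP: "FSEP Jsub G F"
  shows "EP G"
  unfolding EP_def
proof (intro ballI)
  fix A B \<pi> \<phi>
  assume A: "A \<in> finite_images G" and B: "B \<in> finite_images G"
    and \<pi>: "\<pi> \<in> continuous_epi A B" and \<phi>: "\<phi> \<in> continuous_epi G B"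
  from A have A': "profinite_group A" "finite (carrier A)"
    by (simp_all add: finite_images_def)
  from B have B': "profinite_group B" "finite (carrier B)"
    by (simp_all add: finite_images_def)
  obtain \<theta> where \<theta>: "\<theta> \<in> continuous_epi G A"
    using A by (auto simp: finite_images_def)
  interpret A: profinite_group A by fact
  interpret G: profinite_group G
    using GF by (simp add: sorted_profinite_group_def)
  have "{x \<in> carrier G. \<theta> x \<in> {\<one>\<^bsub>A\<^esub>}} \<in> open_normal_subgroups G"
    using open_normal_subgroup_vimage[OF _ _ \<theta> A.one_open_normal[OF A'(2)]]
      G.topological_group_axioms A.topological_group_axioms by simp
  then obtain J where J: "J \<in> F {x \<in> carrier G. \<theta> x \<in> {\<one>\<^bsub>A\<^esub>}}"
    using GF sorting_data_nonempty by (force simp: sorted_profinite_group_def)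
  obtain \<psi> where "\<psi> \<in> sorted_morphisms G F A (principal_sorting Jsub A J)"
    and "\<And>x. x \<in> carrier G \<Longrightarrow> \<pi> (\<psi> x) = \<phi> x"
    using FSEP_lift[where F = F, OF GF FSEP A' B' \<theta> J \<pi> \<phi>] by blast
  thus "\<exists>\<psi>\<in>continuous_epi G A. \<forall>x\<in>carrier G. \<pi> (\<psi> x) = \<phi> x"
    by (auto simp: sorted_morphisms_def)
qed

text \<open>With the identity as \<open>\<pi>\<close> the lift has no freedom: it agrees with the
  given map of kernel \<open>N'\<close>. What FSEP adds is that this map is sorted for data built
  from a word at the kernel \<open>N\<close> of another map.\<close>

lemma FSEP_imp_sorting_subset:
  assumes GF: "sorted_profinite_group Jsub G F" and FSEP: "FSEP Jsub G F"
    and N: "N \<in> open_normal_subgroups G" and N': "N' \<in> open_normal_subgroups G"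
    and iso: "(G Mod N) \<cong> (G Mod N')"
  shows "F N \<subseteq> F N'"
proof
  fix J assume "J \<in> F N"
  interpret G: profinite_group G
    using GF by (simp add: sorted_profinite_group_def)
  note G = G.topological_group_axioms
  have grp: "group (G Mod N)" "group (G Mod N')"
    using N N' normal.factorgroup_is_group by (auto simp: open_normal_subgroups_def)
  have "finite (carrier (G Mod N))"
    using G.finite_rcosets[OF N] by (simp add: FactGroup_def)
  then obtain A :: "nat topgroup"
    where A: "profinite_group A" "finite (carrier A)" and NA: "(G Mod N) \<cong> A"
    using nat_copy_of_finite_group[OF grp(1)] by blast
  interpret A: profinite_group A by fact
  \<comment> \<open>A single copy \<open>A\<close> serves both quotients.\<close>
  have N'A: "(G Mod N') \<cong> A"
    using iso NA group.iso_sym[OF grp(1)] iso_trans by blast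
  obtain q where q: "q \<in> continuous_epi G A" "{x \<in> carrier G. q x \<in> {\<one>\<^bsub>A\<^esub>}} = N"
    by (rule quotient_epi_exists[OF G N A NA])
  obtain q' where q': "q' \<in> continuous_epi G A" "{x \<in> carrier G. q' x \<in> {\<one>\<^bsub>A\<^esub>}} = N'"
    by (rule quotient_epi_exists[OF G N' A N'A])
  have "J \<in> F {x \<in> carrier G. q x \<in> {\<one>\<^bsub>A\<^esub>}}"
    using \<open>J \<in> F N\<close> q(2) by simp
  moreover have "(\<lambda>x. x) \<in> continuous_epi A A"
    by (simp add: continuous_epi_def epi_def hom_def)
  ultimately obtain \<psi> where \<psi>: "\<psi> \<in> sorted_morphisms G F A (principal_sorting Jsub A J)"
    and eq: "\<And>x. x \<in> carrier G \<Longrightarrow> \<psi> x = q' x"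
    using FSEP_lift[where F = F and \<pi> = "\<lambda>x. x", OF GF FSEP A A q(1) _ _ q'(1)] by blast
  \<comment> \<open>This is the morphism condition at the trivial subgroup, where the generator
    \<open>J\<close> sits.\<close>
  have "J \<in> F {x \<in> carrier G. \<psi> x \<in> {\<one>\<^bsub>A\<^esub>}}"
    using \<psi> A.one_open_normal[OF A(2)] mem_principal_sorting[of J Jsub A]
    unfolding sorted_morphisms_def by blast
  moreover have "{x \<in> carrier G. \<psi> x \<in> {\<one>\<^bsub>A\<^esub>}} = N'"
    using eq q'(2) by auto
  ultimately show "J \<in> F N'" by simp
qed

text \<open>EP gives a lift \<open>\<psi>\<close> without control of the sorting. It is compared
  with a morphism \<open>\<theta>\<close> that exists because \<open>A\<close> is a sorted quotient:
  the two preimages of \<open>N\<close> both have quotient \<open>A Mod N\<close>, so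
  \<open>F\<close> agrees on them and the morphism condition carries over from
  \<open>\<theta>\<close> to \<open>\<psi>\<close>.\<close>

lemma EP_imp_SEP:
  assumes GF: "sorted_profinite_group Jsub G F" and EP: "EP G"
    and inv: "\<And>N N'. \<lbrakk>N \<in> open_normal_subgroups G; N' \<in> open_normal_subgroups G;
                (G Mod N) \<cong> (G Mod N')\<rbrakk> \<Longrightarrow> F N = F N'"
  shows "SEP Jsub G F"
proof -
  interpret G: profinite_group G
    using GF by (simp add: sorted_profinite_group_def)
  note G = G.topological_group_axioms
  have "\<exists>\<psi>\<in>sorted_morphisms G F A FA. \<forall>x\<in>carrier G. \<pi> (\<psi> x) = \<phi> x"
    if A: "(A, FA) \<in> SIm Jsub G F" and B: "(B, FB) \<in> SIm Jsub G F"
      and \<pi>: "\<pi> \<in> sorted_morphisms A FA B FB" and \<phi>: "\<phi> \<in> sorted_morphisms G F B FB"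
    for A FA B FB \<pi> \<phi>
  proof -
    obtain \<theta> where \<theta>: "\<theta> \<in> sorted_morphisms G F A FA"
      using A by (auto simp: SIm_def)
    interpret A: profinite_group A
      using A by (simp add: SIm_def sorted_profinite_group_def)
    note tA = A.topological_group_axioms
    have "A \<in> finite_images G" "B \<in> finite_images G"
      using A B by (auto simp: SIm_def finite_images_def sorted_profinite_group_def sorted_morphisms_def)
    moreover have "\<pi> \<in> continuous_epi A B" "\<phi> \<in> continuous_epi G B" and \<theta>': "\<theta> \<in> continuous_epi G A"
      using \<pi> \<phi> \<theta> by (auto simp: sorted_morphisms_def)
    ultimately obtain \<psi> where \<psi>: "\<psi> \<in> continuous_epi G A"
      and eq: "\<forall>x\<in>carrier G. \<pi> (\<psi> x) = \<phi> x"
      using EP unfolding EP_def by blast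
    have "FA N \<subseteq> F {x \<in> carrier G. \<psi> x \<in> N}" if N: "N \<in> open_normal_subgroups A" for N
    proof -
      have "group (G Mod {x \<in> carrier G. \<psi> x \<in> N})"
        using open_normal_subgroup_vimage[OF G tA \<psi> N] normal.factorgroup_is_group
        by (auto simp: open_normal_subgroups_def)
      hence "(G Mod {x \<in> carrier G. \<theta> x \<in> N}) \<cong> (G Mod {x \<in> carrier G. \<psi> x \<in> N})"
        using continuous_epi_FactGroup_iso[OF G tA _ N] \<theta>' \<psi> group.iso_sym iso_trans by blast
      hence "F {x \<in> carrier G. \<theta> x \<in> N} = F {x \<in> carrier G. \<psi> x \<in> N}"
        using inv open_normal_subgroup_vimage[OF G tA _ N] \<theta>' \<psi> by blast
      thus ?thesis
        using \<theta> N by (auto simp: sorted_morphisms_def)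
    qed
    hence "\<psi> \<in> sorted_morphisms G F A FA"
      using \<psi> by (simp add: sorted_morphisms_def)
    thus ?thesis using eq by blast
  qed
  thus ?thesis
    unfolding SEP_def by fast
qed

theorem theorem2p22:
  fixes Jsub :: "nat \<times> 'j list \<Rightarrow> 'j list"
    and G :: "'a topgroup"
    and F :: "'a set \<Rightarrow> 'j list set"
  assumes "Jsub \<in> {1..} \<times> words \<rightarrow> words"
    and "sorted_profinite_group Jsub G F"
  shows "(SEP Jsub G F \<longleftrightarrow> FSEP Jsub G F) \<and>
         (FSEP Jsub G F \<longleftrightarrow>
            EP G \<and>
            (\<forall>N \<in> open_normal_subgroups G. \<forall>N' \<in> open_normal_subgroups G.
               (G Mod N) \<cong> (G Mod N') \<longrightarrow> F N = F N'))"
proof -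
  note GF = assms(2)
  \<comment> \<open>The inclusion is applied in both directions, the second time to the inverse
    isomorphism.\<close>
  have eq: "F N = F N'" if "FSEP Jsub G F" "N \<in> open_normal_subgroups G"
    "N' \<in> open_normal_subgroups G" "(G Mod N) \<cong> (G Mod N')" for N N'
  proof -
    have "group (G Mod N)"
      using that(2) normal.factorgroup_is_group by (auto simp: open_normal_subgroups_def)
    hence "(G Mod N') \<cong> (G Mod N)"
      using that(4) group.iso_sym by blast
    thus ?thesis
      using FSEP_imp_sorting_subset[OF GF] that by blast
  qed
  show ?thesis
    using SEP_imp_FSEP FSEP_imp_EP[OF GF] eq EP_imp_SEP[OF GF] by blast
qed

end
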